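(* Let $\mathcal{C}\subset\mathbb{R}^n$ be $\alpha$-prox-regular for some $\alpha>0$, let $x\in\mathcal{C}+\frac{1}{2\alpha}\operatorname{int}\mathbb{B}$ and $v\in\mathbb{R}^n$, and assume that the directional derivative $\overline{v}:=DP_{\mathcal{C}}(x;v)$ exists. Then $$\langle v,\overline{v}\rangle=0\quad\Longleftrightarrow\quad\overline{v}=0.$$
   Context: $\mathbb{R}^n$ carries the usual inner product and 2-norm; $\operatorname{int}\mathbb{B}$ is the open unit ball. $P_{\mathcal{C}}(x)$ is the set of points of $\mathcal{C}$ at minimal Euclidean distance from $x$. $T_x\mathcal{C}$ is the (Bouligand) tangent cone of $\mathcal{C}$ at $x\in\mathcal{C}$. $\mathcal{C}$ is Clarke regular if it is closed and $x\mapsto T_x\mathcal{C}$ is inner semicontinuous; then $N_x\mathcal{C}$ denotes the normal cone, i.e., the polar cone of $T_x\mathcal{C}$. Given $\alpha>0$, a Clarke regular set $\mathcal{C}$ is $\alpha$-prox-regular if for every $x\in\mathcal{C}$ and every $\eta\in N_x\mathcal{C}$ one has $\langle\eta,y-x\rangle\le\alpha\|\eta\|\|y-x\|^2$ for all $y\in\mathcal{C}$. It is known that then $P_{\mathcal{C}}$ is single-valued on the open set $\mathcal{C}+\frac{1}{2\alpha}\operatorname{int}\mathbb{B}$. The directional derivative is $DP_{\mathcal{C}}(x;v):=\lim_{h\to0^+}\frac{P_{\mathcal{C}}(x+hv)-P_{\mathcal{C}}(x)}{h}$. *)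

theory Defs
  imports "HOL-Analysis.Analysis"
begin

definition tangent_cone :: "'a::real_normed_vector set \<Rightarrow> 'a \<Rightarrow> 'a set" where
  "tangent_cone C x = {v. \<exists>(X :: nat \<Rightarrow> 'a) (d :: nat \<Rightarrow> real).
      (\<forall>k. X k \<in> C) \<and> (\<forall>k. d k > 0) \<and> X \<longlonglongrightarrow> x \<and> d \<longlonglongrightarrow> 0 \<and>
      (\<lambda>k. (X k - x) /\<^sub>R d k) \<longlonglongrightarrow> v}"

text \<open>Inner semicontinuity relative to \<open>S\<close>: \<open>F x\<close> is contained in the inner limit of
  \<open>F y\<close> as \<open>y\<close> tends to \<open>x\<close> within \<open>S\<close>.\<close>

definition inner_semicontinuous_on ::
    "'a::topological_space set \<Rightarrow> ('a \<Rightarrow> 'b::topological_space set) \<Rightarrow> bool" where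
  "inner_semicontinuous_on S F \<longleftrightarrow>
     (\<forall>x\<in>S. \<forall>X :: nat \<Rightarrow> 'a. (\<forall>k. X k \<in> S) \<and> X \<longlonglongrightarrow> x \<longrightarrow>
        (\<forall>v\<in>F x. \<exists>V :: nat \<Rightarrow> 'b.
           (\<forall>\<^sub>F k in sequentially. V k \<in> F (X k)) \<and> V \<longlonglongrightarrow> v))"

definition clarke_regular :: "'a::real_normed_vector set \<Rightarrow> bool" where
  "clarke_regular C \<longleftrightarrow> closed C \<and> inner_semicontinuous_on C (tangent_cone C)"

definition polar_cone :: "'a::real_inner set \<Rightarrow> 'a set" where
  "polar_cone K = {w. \<forall>v\<in>K. w \<bullet> v \<le> 0}"

definition normal_cone :: "'a::real_inner set \<Rightarrow> 'a \<Rightarrow> 'a set" where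
  "normal_cone C x = polar_cone (tangent_cone C x)"

definition prox_regular :: "real \<Rightarrow> 'a::real_inner set \<Rightarrow> bool" where
  "prox_regular \<alpha> C \<longleftrightarrow> clarke_regular C \<and>
     (\<forall>x\<in>C. \<forall>\<eta>\<in>normal_cone C x. \<forall>y\<in>C. \<eta> \<bullet> (y - x) \<le> \<alpha> * norm \<eta> * (norm (y - x))\<^sup>2)"

text \<open>\<open>has_dir_deriv f w x v\<close>: the one-sided directional derivative of \<open>f\<close> at \<open>x\<close> in
  direction \<open>v\<close> exists and equals \<open>w\<close>.\<close>

definition has_dir_deriv ::
    "('a::real_normed_vector \<Rightarrow> 'b::real_normed_vector) \<Rightarrow> 'b \<Rightarrow> 'a \<Rightarrow> 'a \<Rightarrow> bool" where
  "has_dir_deriv f w x v \<longleftrightarrow> ((\<lambda>h. (f (x + h *\<^sub>R v) - f x) /\<^sub>R h) \<longlongrightarrow> w) (at_right 0)"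

text \<open>The metric projection onto \<open>C\<close> is the library function \<^const>\<open>closest_point\<close>, which selects
  a point of \<open>C\<close> at minimal distance. For \<open>\<alpha>\<close>-prox-regular \<open>C\<close> this point is unique on the open
  tube below, and only values there enter the directional derivative at a point of the tube.\<close>

definition open_tube :: "'a::real_normed_vector set \<Rightarrow> real \<Rightarrow> 'a set" where
  "open_tube C r = {c + r *\<^sub>R b | c b. c \<in> C \<and> b \<in> ball 0 1}"

end

theory Submission
  imports Defs
begin

text \<open>With \<open>p = P x\<close> and \<open>p' = P x'\<close>, the residuals \<open>x - p\<close> and \<open>x' - p'\<close> are normal to \<open>C\<close>.
  Adding the two prox-regularity inequalities for the pair \<open>p, p'\<close> gives
  \<open>(1 - \<alpha> (d x + d x')) \<parallel>p' - p\<parallel>\<^sup>2 \<le> \<langle>x' - x, p' - p\<rangle>\<close>, where \<open>d\<close> is the distance to \<open>C\<close>.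
  Putting \<open>x' = x + h v\<close>, dividing by \<open>h\<^sup>2\<close> and letting \<open>h \<rightarrow> 0\<close> yields
  \<open>(1 - 2 \<alpha> d x) \<parallel>vbar\<parallel>\<^sup>2 \<le> \<langle>v, vbar\<rangle>\<close>, and the factor on the left is positive in the tube.\<close>

text \<open>Minimality of \<open>dist x p\<close> bounds \<open>(x - p) \<bullet> (y - p)\<close> by
  half the squared norm of \<open>y - p\<close>. This bound is of second order, so it vanishes in
  the limit of the difference quotients that define a tangent vector.\<close>

lemma nearest_point_diff_in_normal_cone:
  fixes C :: "'a::real_inner set"
  assumes nearest: "\<And>y. y \<in> C \<Longrightarrow> dist x p \<le> dist x y"
  shows "x - p \<in> normal_cone C p"
  unfolding normal_cone_def polar_cone_def
proof (intro CollectI ballI)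
  fix w assume "w \<in> tangent_cone C p"
  then obtain X :: "nat \<Rightarrow> 'a" and d :: "nat \<Rightarrow> real"
    where X: "\<And>k. X k \<in> C" and d: "\<And>k. d k > 0" and Xlim: "X \<longlonglongrightarrow> p"
      and lim: "(\<lambda>k. (X k - p) /\<^sub>R d k) \<longlonglongrightarrow> w"
    unfolding tangent_cone_def by auto
  have bound: "2 * ((x - p) \<bullet> ((X k - p) /\<^sub>R d k)) \<le> ((X k - p) /\<^sub>R d k) \<bullet> (X k - p)" for k
  proof -
    have "(norm (x - p))\<^sup>2 \<le> (norm (x - X k))\<^sup>2"
      using nearest[OF X[of k]] by (intro power_mono) (auto simp: dist_norm)
    then have "2 * ((x - p) \<bullet> (X k - p)) \<le> (X k - p) \<bullet> (X k - p)"
      by (simp add: power2_norm_eq_inner inner_diff_left inner_diff_right inner_commute)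
    from mult_left_mono[OF this, of "inverse (d k)"] d[of k] show ?thesis
      by (simp add: algebra_simps)
  qed
  have "(\<lambda>k. 2 * ((x - p) \<bullet> ((X k - p) /\<^sub>R d k))) \<longlonglongrightarrow> 2 * ((x - p) \<bullet> w)"
    by (intro tendsto_intros lim)
  \<comment> \<open>Only one factor is divided by \<open>d k\<close>: the quotient tends to
    \<open>w\<close>, the other factor to zero.\<close>
  moreover have "(\<lambda>k. ((X k - p) /\<^sub>R d k) \<bullet> (X k - p)) \<longlonglongrightarrow> w \<bullet> (p - p)"
    by (intro tendsto_intros lim Xlim)
  ultimately have "2 * ((x - p) \<bullet> w) \<le> w \<bullet> (p - p)"
    by (rule LIMSEQ_le) (use bound in blast)
  then show "(x - p) \<bullet> w \<le> 0" by simp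
qed

lemma prox_regular_closest_point_le:
  fixes C :: "'a::euclidean_space set"
  assumes prox: "prox_regular \<alpha> C" and "C \<noteq> {}" and y: "y \<in> C"
  shows "(x - closest_point C x) \<bullet> (y - closest_point C x)
           \<le> \<alpha> * dist x (closest_point C x) * (norm (y - closest_point C x))\<^sup>2"
proof -
  have "closed C" using prox by (auto simp: prox_regular_def clarke_regular_def)
  then have "closest_point C x \<in> C" "x - closest_point C x \<in> normal_cone C (closest_point C x)"
    using \<open>C \<noteq> {}\<close> by (auto intro: closest_point_in_set nearest_point_diff_in_normal_cone closest_point_le)
  then show ?thesis
    using prox y by (auto simp: prox_regular_def dist_norm)
qed

lemma prox_regular_closest_point_monotone:
  fixes C :: "'a::euclidean_space set"
  assumes prox: "prox_regular \<alpha> C" and ne: "C \<noteq> {}"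
  defines "P \<equiv> closest_point C"
  shows "(1 - \<alpha> * (dist x (P x) + dist y (P y))) * (norm (P y - P x))\<^sup>2 \<le> (y - x) \<bullet> (P y - P x)"
proof -
  have "closed C" using prox by (auto simp: prox_regular_def clarke_regular_def)
  then have "P z \<in> C" for z unfolding P_def using ne by (rule closest_point_in_set)
  then have "(x - P x) \<bullet> (P y - P x) \<le> \<alpha> * dist x (P x) * (norm (P y - P x))\<^sup>2"
    and "(y - P y) \<bullet> (P x - P y) \<le> \<alpha> * dist y (P y) * (norm (P x - P y))\<^sup>2"
    using prox_regular_closest_point_le[OF prox ne] unfolding P_def by auto
  then have "(x - P x) \<bullet> (P y - P x) + (y - P y) \<bullet> (P x - P y)
      \<le> \<alpha> * (dist x (P x) + dist y (P y)) * (norm (P y - P x))\<^sup>2"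
    by (simp add: norm_minus_commute[of "P x"] algebra_simps)
  \<comment> \<open>The difference of the two residuals is \<open>(x - y) + (P y - P x)\<close>,
    here paired with \<open>P y - P x\<close>.\<close>
  moreover have "(x - P x) \<bullet> (P y - P x) + (y - P y) \<bullet> (P x - P y)
      = (norm (P y - P x))\<^sup>2 - (y - x) \<bullet> (P y - P x)"
    by (simp add: power2_norm_eq_inner inner_diff_left inner_diff_right inner_commute)
  ultimately show ?thesis by (simp add: algebra_simps)
qed

lemma prox_regular_dir_deriv_closest_point_le:
  fixes C :: "'a::euclidean_space set"
  assumes prox: "prox_regular \<alpha> C" and ne: "C \<noteq> {}"
    and deriv: "has_dir_deriv (closest_point C) w x v"
  shows "(1 - 2 * \<alpha> * infdist x C) * (norm w)\<^sup>2 \<le> v \<bullet> w"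
proof -
  define Q where "Q h = (closest_point C (x + h *\<^sub>R v) - closest_point C x) /\<^sub>R h" for h
  have "closed C" using prox by (auto simp: prox_regular_def clarke_regular_def)
  \<comment> \<open>As \<open>infdist\<close> is continuous, the coefficient converges without any
    appeal to continuity of the projection.\<close>
  then have dist_eq: "dist y (closest_point C y) = infdist y C" for y
    using ne by (simp add: infdist_eq_setdist setdist_closest_point)
  have Q: "(Q \<longlongrightarrow> w) (at_right 0)"
    using deriv by (simp add: has_dir_deriv_def Q_def[abs_def])
  have "((\<lambda>h. infdist (x + h *\<^sub>R v) C) \<longlongrightarrow> infdist (x + 0 *\<^sub>R v) C) (at_right 0)"
    by (intro tendsto_intros)
  then have "((\<lambda>h. (1 - \<alpha> * (infdist x C + infdist (x + h *\<^sub>R v) C)) * (norm (Q h))\<^sup>2)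
      \<longlongrightarrow> (1 - \<alpha> * (infdist x C + infdist (x + 0 *\<^sub>R v) C)) * (norm w)\<^sup>2) (at_right 0)"
    by (intro tendsto_intros Q)
  moreover have "((\<lambda>h. v \<bullet> Q h) \<longlongrightarrow> v \<bullet> w) (at_right 0)"
    by (intro tendsto_intros Q)
  moreover have "\<forall>\<^sub>F h in at_right 0.
      (1 - \<alpha> * (infdist x C + infdist (x + h *\<^sub>R v) C)) * (norm (Q h))\<^sup>2 \<le> v \<bullet> Q h"
    using eventually_at_right_less[of "0::real"]
  proof eventually_elim
    case (elim h)
    have diff: "closest_point C (x + h *\<^sub>R v) - closest_point C x = h *\<^sub>R Q h"
      using elim by (simp add: Q_def)
    \<comment> \<open>On the right, one factor \<open>h\<close> comes from the displacement
      \<open>h *\<^sub>R v\<close> and one from \<open>diff\<close>; on the left, both come from the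
      squared norm.\<close>
    have "h\<^sup>2 * ((1 - \<alpha> * (infdist x C + infdist (x + h *\<^sub>R v) C)) * (norm (Q h))\<^sup>2)
        \<le> h\<^sup>2 * (v \<bullet> Q h)"
      using prox_regular_closest_point_monotone[OF prox ne, of x "x + h *\<^sub>R v"]
      unfolding diff dist_eq by (simp add: power_mult_distrib power2_eq_square mult_ac)
    then show ?case using elim by (simp add: mult_le_cancel_left)
  qed
  ultimately have "(1 - \<alpha> * (infdist x C + infdist (x + 0 *\<^sub>R v) C)) * (norm w)\<^sup>2 \<le> v \<bullet> w"
    by (intro tendsto_le[of "at_right (0::real)"]) auto
  then show ?thesis by (simp add: algebra_simps)
qed

theorem lemma8:
  fixes C :: "(real ^ 'n) set" and \<alpha> :: real and x v vbar :: "real ^ 'n"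
  assumes "\<alpha> > 0"
    and "prox_regular \<alpha> C"
    and "x \<in> open_tube C (1 / (2 * \<alpha>))"
    and "has_dir_deriv (closest_point C) vbar x v"
  shows "v \<bullet> vbar = 0 \<longleftrightarrow> vbar = 0"
proof
  assume orth: "v \<bullet> vbar = 0"
  obtain c b where c: "c \<in> C" and b: "norm b < 1" and x: "x = c + (1 / (2 * \<alpha>)) *\<^sub>R b"
    using assms(3) by (auto simp: open_tube_def)
  \<comment> \<open>The tube radius turns this bound into
    \<open>2 * \<alpha> * infdist x C \<le> norm b < 1\<close>, so the factor in front of the
    squared norm of \<open>vbar\<close> is strictly positive.\<close>
  have "infdist x C \<le> dist x c" using c by (rule infdist_le)
  also have "\<dots> = norm b / (2 * \<alpha>)" using x \<open>\<alpha> > 0\<close> by (simp add: dist_norm)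
  finally have "2 * \<alpha> * infdist x C \<le> norm b" using \<open>\<alpha> > 0\<close> by (simp add: field_simps)
  then have "1 - 2 * \<alpha> * infdist x C > 0" using b by simp
  moreover have "(1 - 2 * \<alpha> * infdist x C) * (norm vbar)\<^sup>2 \<le> 0"
    using prox_regular_dir_deriv_closest_point_le[OF assms(2) _ assms(4)] c orth by auto
  ultimately show "vbar = 0" by (simp add: mult_le_0_iff)
qed simp

end
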